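(* The iBlackhole algorithm is complete and correct: for every finite directed graph $G=(V,E)$ and every integer $n\ge 1$, the output $\mathit{Blackhole}$ of iBlackhole$(G,n)$ is exactly the set of all $i$-node blackholes of $G$ with $1\le i\le n$. That is, every $i$-node blackhole with $1\le i\le n$ is in the output (completeness), and every element of the output is an $i$-node blackhole of $G$ for some $1\le i\le n$ (correctness).
   Context: Directed graphs $G=(V,E)$ have no self-loops and no more than one edge between any pair of nodes. An edge $(x,y)$ is directed from $x$ to $y$. For $B\subseteq V$, $d_{out}(B)$ is the number of edges $(x,y)\in E$ with $x\in B$, $y\in V\setminus B$; for a node $v$, $d_{out}(v)$ is its out-degree. A set $B\subseteq V$ is a blackhole if (1) whenever $|B|\ge 2$, the subgraph $G(B)$ induced by $B$ is weakly connected, and (2) $d_{out}(B)=0$. It is an $i$-node blackhole if moreover $|B|=i$. A single-node induced subgraph counts as weakly connected. A directed path from $v_0$ to $v_k$ is a sequence of pairwise distinct nodes $v_0,\dots,v_k$ with $(v_{j-1},v_j)\in E$ for all $1\le j\le k$. If there is a directed path from $u$ to $v$, then $u$ is a predecessor of $v$; if $(u,v)\in E$, then $v$ is a direct successor of $u$. The closure of $v$ is $v^+=\{s : \text{there is a directed path from } v \text{ to } s\}\cup\{v\}$ (computed in $G$). Algorithm iBlackhole$(G,n)$. Set $\mathit{Blackhole}\leftarrow\emptyset$ and $C_0\leftarrow\emptyset$. For $i=1,\dots,n$ do: (a) $P_i\leftarrow\{v\in V: d_{out}(v)<i\}$. (b) For each $v$ in $P_i$: if $v\notin C_{i-1}$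 and at least one direct successor of $v$ is not in (the current) $P_i$, remove $v$ and all its predecessors from $P_i$. (c) $C_i\leftarrow P_i$. (d) For each $v$ in $C_i$: if $|v^+|>i$, remove $v$ and all its predecessors from $C_i$; if $|v^+|=i$, add the set $v^+$ as an element of $\mathit{Blackhole}$ and remove $v$ and all its predecessors from $C_i$. (e) $F_i\leftarrow C_i$. (f) For each subset $B\subseteq F_i$ with $|B|=i$: if $G(B)$ is weakly connected and $d_{out}(B)=0$, add $B$ as an element of $\mathit{Blackhole}$. Return $\mathit{Blackhole}$. In each "for each" loop in (b) and (d) the nodes are processed one after another in an arbitrary order, and nodes already removed from the list are not processed. *)

theory Defs
  imports "Graph_Theory.Graph_Theory"
begin

definition d_out :: "('a, 'b) pre_digraph \<Rightarrow> 'a set \<Rightarrow> nat" where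
  "d_out G B = card {e \<in> arcs G. tail G e \<in> B \<and> head G e \<in> verts G - B}"

text \<open>\<^const>\<open>connected\<close> is weak connectivity: strong connectivity of the symmetrised digraph.\<close>

definition blackhole :: "('a, 'b) pre_digraph \<Rightarrow> 'a set \<Rightarrow> bool" where
  "blackhole G B \<longleftrightarrow>
     B \<subseteq> verts G \<and> (2 \<le> card B \<longrightarrow> connected (G \<restriction> B)) \<and> d_out G B = 0"

definition node_blackhole :: "('a, 'b) pre_digraph \<Rightarrow> nat \<Rightarrow> 'a set \<Rightarrow> bool" where
  "node_blackhole G i B \<longleftrightarrow> blackhole G B \<and> card B = i"

text \<open>The one-node path is admitted, so a node counts among its own predecessors. This makes no
  difference below, where predecessors of a node are only ever removed together with the node.\<close>

definition predecessors :: "('a, 'b) pre_digraph \<Rightarrow> 'a \<Rightarrow> 'a set" where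
  "predecessors G v = {u. \<exists>p. pre_digraph.apath G u p v}"

definition direct_successors :: "('a, 'b) pre_digraph \<Rightarrow> 'a \<Rightarrow> 'a set" where
  "direct_successors G v = {w. v \<rightarrow>\<^bsub>G\<^esub> w}"

definition node_closure :: "('a, 'b) pre_digraph \<Rightarrow> 'a \<Rightarrow> 'a set" where
  "node_closure G v = {s. \<exists>p. pre_digraph.apath G v p s} \<union> {v}"

text \<open>The arbitrary processing order of a loop is a list enumerating the nodes present when the
  loop starts; each of its nodes is skipped if it has been removed before its turn.\<close>

definition enumerates :: "'a list \<Rightarrow> 'a set \<Rightarrow> bool" where
  "enumerates xs A \<longleftrightarrow> distinct xs \<and> set xs = A"

text \<open>Body of the loop in step (b). \<open>C'\<close> is the list $C_{i-1}$ as the previous iteration left it.\<close>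

definition prune_potential ::
  "('a, 'b) pre_digraph \<Rightarrow> 'a set \<Rightarrow> 'a \<Rightarrow> 'a set \<Rightarrow> 'a set" where
  "prune_potential G C' v P =
     (if v \<in> P \<and> v \<notin> C' \<and> (\<exists>w \<in> direct_successors G v. w \<notin> P)
      then P - ({v} \<union> predecessors G v) else P)"

text \<open>Body of the loop in step (d), acting on the pair of $C_i$ and \<open>Blackhole\<close>.\<close>

definition prune_candidates ::
  "('a, 'b) pre_digraph \<Rightarrow> nat \<Rightarrow> 'a \<Rightarrow> 'a set \<times> 'a set set \<Rightarrow> 'a set \<times> 'a set set" where
  "prune_candidates G i v = (\<lambda>(C, BH).
     if v \<notin> C then (C, BH)
     else if card (node_closure G v) > i then (C - ({v} \<union> predecessors G v), BH)
     else if card (node_closure G v) = i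
       then (C - ({v} \<union> predecessors G v), insert (node_closure G v) BH)
     else (C, BH))"

definition exhaustive_search :: "('a, 'b) pre_digraph \<Rightarrow> nat \<Rightarrow> 'a set \<Rightarrow> 'a set set" where
  "exhaustive_search G i F = {B. B \<subseteq> F \<and> card B = i \<and> connected (G \<restriction> B) \<and> d_out G B = 0}"

text \<open>\<open>iBlackhole_state G i C BH\<close>: for some choice of processing orders, \<open>C\<close> and \<open>BH\<close> are the values
  of $C_i$ and \<open>Blackhole\<close> after iterations $1, \ldots, i$.\<close>

inductive iBlackhole_state ::
  "('a, 'b) pre_digraph \<Rightarrow> nat \<Rightarrow> 'a set \<Rightarrow> 'a set set \<Rightarrow> bool" for G where
  init: "iBlackhole_state G 0 {} {}"
| iteration:
    "\<lbrakk> iBlackhole_state G (i - 1) C' BH'; 1 \<le> i;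
       P0 = {v \<in> verts G. out_degree G v < i};
       enumerates xs P0;
       P = fold (prune_potential G C') xs P0;
       enumerates ys P;
       (F, BH) = fold (prune_candidates G i) ys (P, BH') \<rbrakk>
     \<Longrightarrow> iBlackhole_state G i F (BH \<union> exhaustive_search G i F)"

definition iBlackhole :: "('a, 'b) pre_digraph \<Rightarrow> nat \<Rightarrow> 'a set set \<Rightarrow> bool" where
  "iBlackhole G n BH \<longleftrightarrow> (\<exists>C. iBlackhole_state G n C BH)"

end

(* A set with no outgoing edges contains every node reachable from it, so it is disjoint from the
   predecessors of each node outside it. An i-node blackhole B therefore survives step (b): its nodes
   have out-degree below i, and as long as B lies in the list, no node of B has a successor off the
   list. In step (d), a node v of B has closure inside B, so either the closure has fewer than i
   nodes, and v is kept, or the closure is B, and B is recorded. Hence B is recorded or survives to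
   the exhaustive search. *)
theory Submission
  imports Defs
begin

section \<open>Closed sets and closures\<close>

context wf_digraph
begin

text \<open>Walks shorten to paths with pairwise distinct nodes, so reachability can replace paths
  and gives access to induction.\<close>

lemma predecessors_eq: "predecessors G v = {u. u \<rightarrow>\<^sup>* v}"
  by (simp add: predecessors_def reachable_apath)

lemma node_closure_eq: "v \<in> verts G \<Longrightarrow> node_closure G v = {s. v \<rightarrow>\<^sup>* s}"
  by (auto simp: node_closure_def reachable_apath[symmetric])

lemma node_closure_subset_verts: "v \<in> verts G \<Longrightarrow> node_closure G v \<subseteq> verts G"
  by (auto simp: node_closure_eq dest: reachable_in_verts)

text \<open>\<open>v\<close> serves as a hub: it reaches each node of its closure without leaving
  the closure, and symmetrising supplies the way back.\<close>

lemma connected_node_closure: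
  assumes v: "v \<in> verts G"
  shows "connected (G \<restriction> node_closure G v)"
proof -
  let ?H = "G \<restriction> node_closure G v"
  interpret H: wf_digraph ?H by (rule wellformed_induce_subgraph)
  interpret S: pair_wf_digraph "mk_symmetric ?H" by (rule H.wellformed_mk_symmetric)
  \<comment> \<open>Every node on the way is itself reachable from \<open>v\<close>, so each arc
    used survives in the induced subgraph.\<close>
  have reach: "v \<rightarrow>\<^sup>*\<^bsub>?H\<^esub> s" if "v \<rightarrow>\<^sup>* s" for s
    using that
  proof (induct rule: reachable_induct)
    case base
    then show ?case by (intro H.reachable_refl) (simp add: node_closure_def)
  next
    case (step x y)
    then have "x \<in> node_closure G v" "y \<in> node_closure G v"
      using v by (auto simp: node_closure_eq intro: reachable_adj_trans)
    with step(2) have "x \<rightarrow>\<^bsub>?H\<^esub> y" by (auto simp: arcs_ends_conv intro!: rev_image_eqI)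
    with step(3) show ?case by (rule H.reachable_adj_trans)
  qed
  have from_v: "v \<rightarrow>\<^sup>*\<^bsub>mk_symmetric ?H\<^esub> s" if "s \<in> node_closure G v" for s
    using that v reach H.reachable_mk_symmetricI by (simp add: node_closure_eq)
  have to_v: "s \<rightarrow>\<^sup>*\<^bsub>mk_symmetric ?H\<^esub> v" if "s \<in> node_closure G v" for s
    using symmetric_mk_symmetric from_v[OF that] by (rule symmetric_reachable)
  show ?thesis
    unfolding connected_def
  proof (rule strongly_connectedI)
    show "verts (with_proj (mk_symmetric ?H)) \<noteq> {}"
      by (auto simp: node_closure_def)
    fix s t
    assume "s \<in> verts (with_proj (mk_symmetric ?H))" "t \<in> verts (with_proj (mk_symmetric ?H))"
    then show "s \<rightarrow>\<^sup>*\<^bsub>mk_symmetric ?H\<^esub> t"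
      using S.reachable_trans[OF to_v from_v] by simp
  qed
qed

lemma connected_singleton: "connected (G \<restriction> {v})"
proof -
  interpret H: wf_digraph "G \<restriction> {v}" by (rule wellformed_induce_subgraph)
  interpret S: pair_wf_digraph "mk_symmetric (G \<restriction> {v})" by (rule H.wellformed_mk_symmetric)
  show ?thesis
    unfolding connected_def by (rule strongly_connectedI) auto
qed

text \<open>Bridges \<open>blackhole\<close>, which asks for connectedness from two nodes on, and
  \<open>exhaustive_search\<close>, which tests it at every size. The bound excludes the empty set,
  which \<open>connected\<close> rejects.\<close>

lemma blackhole_connected:
  assumes "blackhole G B" "1 \<le> card B"
  shows "connected (G \<restriction> B)"
proof (cases "2 \<le> card B")
  case True
  with assms show ?thesis by (simp add: blackhole_def)
next
  case False
  with assms(2) have "card B = 1" by linarith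
  then show ?thesis using connected_singleton by (auto simp: card_1_singleton_iff)
qed

end

context fin_digraph
begin

lemma d_out_eq_0_iff: "d_out G B = 0 \<longleftrightarrow> (\<forall>u \<in> B. \<forall>w. u \<rightarrow> w \<longrightarrow> w \<in> B)"
proof -
  \<comment> \<open>\<open>card\<close> also vanishes on infinite sets, so finiteness has to be
    known before a zero count means that no arc leaves \<open>B\<close>.\<close>
  have "finite {e \<in> arcs G. tail G e \<in> B \<and> head G e \<in> verts G - B}"
    by simp
  then show ?thesis
    unfolding d_out_def by (auto simp: arcs_ends_conv)
qed

lemma d_out_eq_0_reachable:
  assumes "d_out G B = 0" "u \<rightarrow>\<^sup>* w" "u \<in> B"
  shows "w \<in> B"
  using assms(2,3) by (induct rule: reachable_induct) (use assms(1) in \<open>auto simp: d_out_eq_0_iff\<close>)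

lemma d_out_eq_0_disjoint_predecessors:
  assumes "d_out G B = 0" "v \<notin> B"
  shows "B \<inter> ({v} \<union> predecessors G v) = {}"
  using assms d_out_eq_0_reachable by (auto simp: predecessors_eq)

lemma node_closure_subset:
  assumes "d_out G B = 0" "v \<in> B"
  shows "node_closure G v \<subseteq> B"
  using assms d_out_eq_0_reachable
  by (auto simp: node_closure_def reachable_apath[symmetric])

text \<open>Justifies what step (d) records: a successor of a node reachable from \<open>v\<close>
  is reachable too, so no arc leaves the closure.\<close>

lemma blackhole_node_closure:
  assumes "v \<in> verts G"
  shows "blackhole G (node_closure G v)"
  unfolding blackhole_def d_out_eq_0_iff
  using assms connected_node_closure node_closure_subset_verts
  by (auto simp: node_closure_eq intro: reachable_adj_trans)

end

text \<open>Arcs out of \<open>v\<close> end in \<open>B\<close>; without parallel arcs their heads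
  differ, and without loops no head is \<open>v\<close>.\<close>

lemma (in digraph) out_degree_less_card:
  assumes "B \<subseteq> verts G" "d_out G B = 0" "v \<in> B"
  shows "out_degree G v < card B"
proof -
  have fin: "finite B" using assms(1) finite_verts by (rule finite_subset)
  have "inj_on (head G) (out_arcs G v)"
    by (rule inj_onI) (auto intro!: no_multi_arcs simp: arc_to_ends_def)
  then have "out_degree G v = card (head G ` out_arcs G v)"
    by (simp add: out_degree_def card_image)
  also have "\<dots> \<le> card (B - {v})"
  proof (rule card_mono)
    show "head G ` out_arcs G v \<subseteq> B - {v}"
      using assms(2,3) no_loops by (auto simp: d_out_eq_0_iff arcs_ends_conv)
  qed (use fin in simp)
  also have "\<dots> < card B" using fin assms(3) by (rule card_Diff1_less)
  finally show ?thesis .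
qed

section \<open>The two pruning loops\<close>

lemma prune_potential_subset: "fold (prune_potential G C') xs P \<subseteq> P"
  by (rule fold_invariant[where Q = "\<lambda>_. True"]) (auto simp: prune_potential_def)

lemma (in fin_digraph) prune_potential_keeps_closed:
  assumes "d_out G B = 0" "B \<subseteq> P"
  shows "B \<subseteq> fold (prune_potential G C') xs P"
proof (rule fold_invariant[where Q = "\<lambda>_. True"])
  \<comment> \<open>This \<open>P\<close> shadows the starting list: it is the list at an arbitrary
    moment of the loop, under any processing order.\<close>
  fix v P
  assume B: "B \<subseteq> P"
  show "B \<subseteq> prune_potential G C' v P"
  proof (cases "v \<in> B")
    case True
    then have "direct_successors G v \<subseteq> P"
      using B assms(1) by (auto simp: direct_successors_def d_out_eq_0_iff)
    then show ?thesis using B by (auto simp: prune_potential_def)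
  next
    case False
    then show ?thesis
      using B d_out_eq_0_disjoint_predecessors[OF assms(1), of v]
      by (auto simp: prune_potential_def)
  qed
qed (use assms(2) in auto)

lemma prune_candidates_sound:
  assumes "fold (prune_candidates G i) ys (P, BH) = (F, BH')"
  shows "F \<subseteq> P"
    and "BH \<subseteq> BH'"
    and "BH' \<subseteq> BH \<union> {node_closure G v | v. v \<in> P \<and> card (node_closure G v) = i}"
proof -
  \<comment> \<open>The three claims form one invariant, since the third relies on the first: a node
    processed from the current list must lie in the starting list \<open>P\<close>.\<close>
  let ?I = "\<lambda>(F, BH'). F \<subseteq> P \<and> BH \<subseteq> BH' \<and>
    BH' \<subseteq> BH \<union> {node_closure G v | v. v \<in> P \<and> card (node_closure G v) = i}"
  have "?I (fold (prune_candidates G i) ys (P, BH))"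
    by (rule fold_invariant[where Q = "\<lambda>_. True"])
      (auto simp: prune_candidates_def split: prod.splits if_splits)
  then show "F \<subseteq> P" "BH \<subseteq> BH'"
    "BH' \<subseteq> BH \<union> {node_closure G v | v. v \<in> P \<and> card (node_closure G v) = i}"
    unfolding assms by simp_all
qed

lemma (in fin_digraph) prune_candidates_keeps_blackhole:
  assumes "node_blackhole G i B" "B \<subseteq> P"
    and "fold (prune_candidates G i) ys (P, BH) = (F, BH')"
  shows "B \<subseteq> F \<or> B \<in> BH'"
proof -
  have d0: "d_out G B = 0" and card: "card B = i" and B: "B \<subseteq> verts G"
    using assms(1) by (auto simp: node_blackhole_def blackhole_def)
  have fin: "finite B" using B finite_verts by (rule finite_subset)
  \<comment> \<open>The list may lose nodes of \<open>B\<close> only when \<open>B\<close> is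
    recorded, and recorded sets are never withdrawn.\<close>
  let ?I = "\<lambda>(C, BH). B \<subseteq> C \<or> B \<in> BH"
  have "?I (fold (prune_candidates G i) ys (P, BH))"
  proof (rule fold_invariant[where Q = "\<lambda>_. True"])
    fix v and s :: "'a set \<times> 'a set set"
    assume I: "?I s"
    show "?I (prune_candidates G i v s)"
    proof (cases "v \<in> B")
      case True
      then have "node_closure G v \<subseteq> B" by (rule node_closure_subset[OF d0])
      then have "card (node_closure G v) \<le> i"
        and "card (node_closure G v) = i \<Longrightarrow> node_closure G v = B"
        using card fin card_mono card_subset_eq by metis+
      then show ?thesis using I by (auto simp: prune_candidates_def split: prod.splits)
    next
      case False
      then show ?thesis
        using I d_out_eq_0_disjoint_predecessors[OF d0, of v]
        by (auto simp: prune_candidates_def split: prod.splits)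
    qed
  qed (use assms(2) in auto)
  then show ?thesis unfolding assms(3) by simp
qed

section \<open>Iterations\<close>

context digraph
begin

lemma iteration_adds_node_blackholes:
  assumes "1 \<le> i"
    and P: "P = fold (prune_potential G C') xs {v \<in> verts G. out_degree G v < i}"
    and F: "fold (prune_candidates G i) ys (P, BH') = (F, BH)"
  shows "BH \<union> exhaustive_search G i F = BH' \<union> {B. node_blackhole G i B}"
proof (intro subset_antisym subsetI)
  have PV: "P \<subseteq> verts G"
    unfolding P by (rule subset_trans[OF prune_potential_subset]) auto
  note sound = prune_candidates_sound[OF F]
  fix B
  assume "B \<in> BH \<union> exhaustive_search G i F"
  then consider "B \<in> BH'"
    | v where "v \<in> P" "card (node_closure G v) = i" "B = node_closure G v"
    | "B \<in> exhaustive_search G i F"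
    using sound(3) by auto
  then show "B \<in> BH' \<union> {B. node_blackhole G i B}"
  proof cases
    case 1
    then show ?thesis by simp
  next
    case 2
    then show ?thesis using PV blackhole_node_closure by (auto simp: node_blackhole_def)
  next
    case 3
    then show ?thesis
      using PV sound(1) by (auto simp: exhaustive_search_def node_blackhole_def blackhole_def)
  qed
next
  fix B
  assume "B \<in> BH' \<union> {B. node_blackhole G i B}"
  then show "B \<in> BH \<union> exhaustive_search G i F"
  proof
    assume "B \<in> BH'"
    then show ?thesis using prune_candidates_sound(2)[OF F] by auto
  next
    assume "B \<in> {B. node_blackhole G i B}"
    then have bh: "node_blackhole G i B" by simp
    then have B: "blackhole G B" "B \<subseteq> verts G" "d_out G B = 0" "card B = i"
      by (auto simp: node_blackhole_def blackhole_def)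
    \<comment> \<open>The out-degree bound places \<open>B\<close> in the list with which step (b)
      starts.\<close>
    then have "B \<subseteq> {v \<in> verts G. out_degree G v < i}"
      using out_degree_less_card by auto
    then have "B \<subseteq> P"
      unfolding P by (rule prune_potential_keeps_closed[OF B(3)])
    then have "B \<subseteq> F \<or> B \<in> BH"
      by (rule prune_candidates_keeps_blackhole[OF bh _ F])
    then show ?thesis
      using B blackhole_connected[OF B(1)] \<open>1 \<le> i\<close> by (auto simp: exhaustive_search_def)
  qed
qed

lemma iBlackhole_state_output:
  assumes "iBlackhole_state G n C BH"
  shows "BH = {B. \<exists>i. 1 \<le> i \<and> i \<le> n \<and> node_blackhole G i B}"
  using assms
proof induct
  case init
  then show ?case by auto
next
  case (iteration i C' BH' P0 xs P ys F BH)
  have "BH \<union> exhaustive_search G i F = BH' \<union> {B. node_blackhole G i B}"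
    using iteration by (intro iteration_adds_node_blackholes) auto
  also have "\<dots> = {B. \<exists>j. 1 \<le> j \<and> j \<le> i - 1 \<and> node_blackhole G j B} \<union> {B. node_blackhole G i B}"
    using iteration(2) by simp
  also have "\<dots> = {B. \<exists>j. 1 \<le> j \<and> j \<le> i \<and> node_blackhole G j B}"
  proof -
    \<comment> \<open>\<open>1 \<le> i\<close> makes the truncated \<open>i - 1\<close> a true
      predecessor and lets \<open>j = i\<close> satisfy \<open>1 \<le> j\<close>.\<close>
    have "1 \<le> j \<and> j \<le> i \<longleftrightarrow> (1 \<le> j \<and> j \<le> i - 1) \<or> j = i" for j
      using \<open>1 \<le> i\<close> by linarith
    then show ?thesis by blast
  qed
  finally show ?case .
qed

text \<open>Keeps the statement about all outputs from being vacuous: the lists stay inside the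
  finite node set, so every loop has a processing order.\<close>

lemma iBlackhole_state_exists: "\<exists>C BH. iBlackhole_state G n C BH"
proof (induct n)
  case 0
  show ?case using iBlackhole_state.init by blast
next
  case (Suc n)
  \<comment> \<open>The index is written \<open>Suc n - 1\<close> to match the premise
    \<open>i - 1\<close> of the rule \<open>iteration\<close>.\<close>
  then obtain C' BH' where state: "iBlackhole_state G (Suc n - 1) C' BH'" by auto
  let ?P0 = "{v \<in> verts G. out_degree G v < Suc n}"
  have enum: "\<exists>xs. enumerates xs A" if "A \<subseteq> verts G" for A
    using finite_distinct_list[OF finite_subset[OF that finite_verts]]
    by (auto simp: enumerates_def)
  obtain xs where xs: "enumerates xs ?P0" using enum[of ?P0] by auto
  let ?P = "fold (prune_potential G C') xs ?P0"
  have "?P \<subseteq> verts G" by (rule subset_trans[OF prune_potential_subset]) auto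
  then obtain ys where ys: "enumerates ys ?P" using enum by blast
  obtain F BH where F: "(F, BH) = fold (prune_candidates G (Suc n)) ys (?P, BH')"
    by (metis surj_pair)
  show ?case
    using iBlackhole_state.iteration[OF state _ refl xs refl ys F] by auto
qed

end

text \<open>\<open>iBlackhole\<close> is a relation because the processing orders are free; hence
  existence of a run is paired with a description of every output.\<close>

theorem mainTheorem2:
  fixes G :: "('a, 'b) pre_digraph" and n :: nat
  assumes "digraph G" and "n \<ge> 1"
  shows "(\<exists>BH. iBlackhole G n BH) \<and>
    (\<forall>BH. iBlackhole G n BH \<longrightarrow> BH = {B. \<exists>i. 1 \<le> i \<and> i \<le> n \<and> node_blackhole G i B})"
proof -
  interpret digraph G by (rule assms(1))
  show ?thesis
    using iBlackhole_state_exists[of n] iBlackhole_state_output[of n]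
    unfolding iBlackhole_def by blast
qed

end
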